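(* Let $L>0$, $\mu>0$, let $f:\mathbb{R}^d\to\mathbb{R}$ be convex and differentiable with $L$-Lipschitz continuous gradient, let $h:\mathbb{R}^d\to\mathbb{R}\cup\{+\infty\}$ be closed, proper and convex, and let $F=f+h$ have a nonempty set of global minimizers, with minimum value $F_*$. Let $\gamma\in(0,\frac2L)$ and $x_1\in\mathbb{R}^d$, and suppose that $F$ satisfies the RPL inequality with constant $\mu$ on $X=\{x:F(x)\le F(x_1)\}$, i.e. $$\|\mathcal{G}_\gamma(x)\|^2\ \ge\ 2\mu\,(F(x)-F_* )\qquad\text{for all }x\in X,$$ where $\mathcal{G}_\gamma(x)=\frac1\gamma\left(x-\mathrm{prox}_{\gamma h}(x-\gamma\nabla f(x))\right)$. Let $x_2=\mathrm{prox}_{\gamma h}(x_1-\gamma\nabla f(x_1))$. Then: 1. If $\gamma\in\left(0,\frac1L\right]$, then $$F(x_2)-F_*\le\frac{1-\gamma\mu}{1+\gamma\mu}\,(F(x_1)-F_* ).$$ 2. If $\gamma\in\left(\frac1L,\frac{3}{2L}\right]$, then $$F(x_2)-F_*\le\frac{-2L\gamma^2\mu+L\gamma+3\gamma\mu-2}{L\gamma-\gamma\mu-2}\,(F(x_1)-F_* ).$$ 3. If $\gamma\in\left(\frac{3}{2L},\frac2L\right)$, then $$F(x_2)-F_*\le\frac{(L\gamma-1)^2}{(L\gamma-1)^2-L\gamma^2\mu+2\gamma\mu}\,(F(x_1)-F_* ).$$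
   Context: $\|\cdot\|$ is the Euclidean norm on $\mathbb{R}^d$. For a closed proper convex function $g$, $\mathrm{prox}_{g}(x)=\operatorname{argmin}_{y\in\mathbb{R}^d}\{g(y)+\frac12\|y-x\|^2\}$. The parameter $\gamma$ in the residual $\mathcal{G}_\gamma$ is the same as the step size of the proximal gradient step. *)

theory Defs
  imports "HOL-Analysis.Analysis"
begin

text \<open>Functions into \<open>\<real> \<union> {+\<infinity>}\<close> are modelled as \<open>ereal\<close>-valued functions; the value
  \<open>-\<infinity>\<close> is excluded by properness.\<close>

definition proper :: "('a \<Rightarrow> ereal) \<Rightarrow> bool" where
  "proper g \<longleftrightarrow> (\<forall>x. g x \<noteq> -\<infinity>) \<and> (\<exists>x. g x \<noteq> \<infinity>)"

text \<open>The weights lie in \<open>[0,1]\<close> and \<open>0 * \<infinity> = 0\<close> in \<open>ereal\<close>, so for proper \<open>g\<close> this is the usual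
  convexity inequality, with no undefined sum \<open>\<infinity> - \<infinity>\<close> on the right.\<close>

definition ereal_convex :: "('a::real_vector \<Rightarrow> ereal) \<Rightarrow> bool" where
  "ereal_convex g \<longleftrightarrow>
     (\<forall>x y. \<forall>u\<ge>0. \<forall>v\<ge>0. u + v = 1 \<longrightarrow>
        g (u *\<^sub>R x + v *\<^sub>R y) \<le> ereal u * g x + ereal v * g y)"

definition closed_fun :: "('a::topological_space \<Rightarrow> ereal) \<Rightarrow> bool" where
  "closed_fun g \<longleftrightarrow> closed {(x, t::real). g x \<le> ereal t}"

text \<open>Meaningful where \<open>f\<close> is differentiable; the gradient is then unique.\<close>

definition gradient :: "('a::euclidean_space \<Rightarrow> real) \<Rightarrow> 'a \<Rightarrow> 'a" where
  "gradient f x = (THE D. GDERIV f x :> D)"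

text \<open>For closed proper convex \<open>g\<close> the minimizer exists and is unique, so the choice made by
  \<open>ARG_MIN\<close> is immaterial.\<close>

definition prox :: "('a::euclidean_space \<Rightarrow> ereal) \<Rightarrow> 'a \<Rightarrow> 'a" where
  "prox g x = (ARG_MIN (\<lambda>y. g y + ereal (1/2 * (norm (y - x))\<^sup>2)) y. True)"

definition prox_grad_step ::
  "('a::euclidean_space \<Rightarrow> real) \<Rightarrow> ('a \<Rightarrow> ereal) \<Rightarrow> real \<Rightarrow> 'a \<Rightarrow> 'a" where
  "prox_grad_step f h \<gamma> x = prox (\<lambda>y. ereal \<gamma> * h y) (x - \<gamma> *\<^sub>R gradient f x)"

definition residual ::
  "('a::euclidean_space \<Rightarrow> real) \<Rightarrow> ('a \<Rightarrow> ereal) \<Rightarrow> real \<Rightarrow> 'a \<Rightarrow> 'a" where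
  "residual f h \<gamma> x = (1 / \<gamma>) *\<^sub>R (x - prox_grad_step f h \<gamma> x)"

end

theory Submission
  imports Defs
begin

text \<open>
  Write \<open>G\<close> for the residual at \<open>x1\<close>. Optimality of the proximal step says that
  \<open>G - gradient f x1\<close> is a subgradient of \<open>h\<close> at \<open>x2\<close>, so that
  \<open>v = gradient f x2 + (G - gradient f x1)\<close> is a subgradient of \<open>F\<close> at \<open>x2\<close>. The step then looks
  like a gradient step with step size \<open>\<gamma>\<close>, starting where the gradient is \<open>G\<close> and ending where
  it is \<open>v\<close>, and the analysis of gradient descent under a Polyak-Lojasiewicz inequality carries over.

  Only two facts about \<open>F\<close> enter. First, \<open>f\<close> satisfies the interpolation inequality of smooth convex
  functions (\<open>smooth_convex_interpolation\<close>) in both directions between \<open>x1\<close> and \<open>x2\<close>; together with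
  the subgradient inequality for \<open>h\<close> at \<open>x2\<close> this encloses a number \<open>E \<le> F x1 - F x2\<close> between two
  quadratic forms in \<open>G\<close> and \<open>v\<close> (\<open>prox_grad_step_decrease_sandwich\<close>). Nonnegative combinations of
  the two, chosen according to the size of \<open>\<gamma> * L\<close>, eliminate the inner product of \<open>G\<close> and \<open>v\<close> and
  bound \<open>E\<close> below by squared norms of \<open>G\<close> and \<open>v\<close> (\<open>decrease_bounds\<close>). Second, the residual at
  \<open>x2\<close> is no longer than the subgradient \<open>v\<close> (\<open>norm_residual_le_subgradient\<close>), so the RPL inequality
  at \<open>x1\<close> and at \<open>x2\<close> turns these norms into the optimality gaps
  \<open>\<Delta>1 = F x1 - F_star\<close> and \<open>\<Delta>2 = F x2 - F_star\<close>. Since \<open>\<Delta>1 - \<Delta>2 \<ge> E\<close>, the result is a linear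
  inequality between \<open>\<Delta>1\<close> and \<open>\<Delta>2\<close>, which is the claimed rate. For long steps the coefficient of
  the squared norm of \<open>G\<close> would become negative; there only \<open>v\<close> is kept.

  The proximal point exists because a minimizer of \<open>F\<close> provides a subgradient of \<open>h\<close>, hence an affine
  minorant, which makes the proximal objective coercive.
\<close>

section \<open>Gradients of smooth convex functions\<close>

lemma gradient_eq:
  fixes f :: "'a::euclidean_space \<Rightarrow> real"
  assumes "GDERIV f x :> D"
  shows "gradient f x = D"
proof -
  have "D' = D" if "GDERIV f x :> D'" for D'
  proof -
    have "(\<lambda>h. h \<bullet> D') = (\<lambda>h. h \<bullet> D)"
      using that assms unfolding gderiv_def by (rule has_derivative_unique)
    then have "h \<bullet> (D' - D) = 0" for h
      by (metis inner_diff_right diff_self)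
    from this[of "D' - D"] show ?thesis by simp
  qed
  then show ?thesis unfolding gradient_def using assms by blast
qed

lemma GDERIV_gradient:
  fixes f :: "'a::euclidean_space \<Rightarrow> real"
  assumes "f differentiable (at x)"
  shows "GDERIV f x :> gradient f x"
proof -
  obtain f' where f': "(f has_derivative f') (at x)"
    using assms unfolding differentiable_def by blast
  have lin: "linear f'" using f' by (rule has_derivative_linear)
  have "f' = (\<lambda>h. h \<bullet> adjoint f' 1)"
    using adjoint_works[OF lin, of _ 1] by (simp add: fun_eq_iff)
  then have "GDERIV f x :> adjoint f' 1"
    using f' unfolding gderiv_def by simp
  then show ?thesis using gradient_eq by metis
qed

lemma GDERIV_along_line:
  fixes f :: "'a::euclidean_space \<Rightarrow> real"
  assumes "GDERIV f (x + s *\<^sub>R d) :> D"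
  shows "((\<lambda>s. f (x + s *\<^sub>R d)) has_real_derivative d \<bullet> D) (at s)"
proof -
  have "((\<lambda>s. x + s *\<^sub>R d) has_derivative (\<lambda>r. r *\<^sub>R d)) (at s)"
    by (auto intro!: derivative_eq_intros)
  then have "((\<lambda>s. f (x + s *\<^sub>R d)) has_derivative (\<lambda>r. (r *\<^sub>R d) \<bullet> D)) (at s)"
    using has_derivative_compose assms unfolding gderiv_def by blast
  then show ?thesis
    by (simp add: has_field_derivative_def mult_commute_abs)
qed

text \<open>
  The common core of the gradient inequality for convex functions and of the optimality condition
  for a smooth plus a convex function: in both, convexity supplies linear growth along a segment.
\<close>
lemma directional_derivative_ge:
  fixes \<phi> :: "'a::euclidean_space \<Rightarrow> real"
  assumes "GDERIV \<phi> x :> D"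
    and growth: "\<And>s. 0 < s \<Longrightarrow> s < 1 \<Longrightarrow> \<phi> x + s * c \<le> \<phi> (x + s *\<^sub>R d)"
  shows "c \<le> D \<bullet> d"
proof -
  have "((\<lambda>s. \<phi> (x + s *\<^sub>R d)) has_real_derivative d \<bullet> D) (at 0)"
    using GDERIV_along_line[of \<phi> x 0 d D] assms(1) by simp
  then have "((\<lambda>s. (\<phi> (x + s *\<^sub>R d) - \<phi> x) / s) \<longlongrightarrow> d \<bullet> D) (at_right 0)"
    unfolding has_field_derivative_iff
    by (auto intro: filterlim_at_split[THEN iffD1, THEN conjunct2])
  moreover have "\<forall>\<^sub>F s in at_right 0. c \<le> (\<phi> (x + s *\<^sub>R d) - \<phi> x) / s"
    unfolding eventually_at_right_field
  proof (intro exI[of _ 1] conjI allI impI)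
    fix s :: real assume "0 < s" "s < 1"
    with growth[of s] show "c \<le> (\<phi> (x + s *\<^sub>R d) - \<phi> x) / s"
      by (simp add: field_simps)
  qed simp
  ultimately have "c \<le> d \<bullet> D"
    by (intro tendsto_lowerbound[where F = "at_right 0"]) auto
  then show ?thesis by (simp add: inner_commute)
qed

lemma convex_on_gradient_le:
  fixes f :: "'a::euclidean_space \<Rightarrow> real"
  assumes "convex_on UNIV f" and "GDERIV f x :> D"
  shows "f x + D \<bullet> (y - x) \<le> f y"
proof -
  \<comment> \<open>Convexity bounds \<open>f\<close> above on the segment, so the growth estimate is one for \<open>- f\<close>.\<close>
  have "f x - f y \<le> (- D) \<bullet> (y - x)"
  proof (rule directional_derivative_ge)
    show "GDERIV (\<lambda>z. - f z) x :> - D" using assms(2) by (rule GDERIV_minus)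
    fix s :: real assume s: "0 < s" "s < 1"
    have "f ((1 - s) *\<^sub>R x + s *\<^sub>R y) \<le> (1 - s) * f x + s * f y"
      using convex_onD[OF assms(1), of s x y] s by simp
    moreover have "(1 - s) *\<^sub>R x + s *\<^sub>R y = x + s *\<^sub>R (y - x)"
      by (simp add: algebra_simps)
    ultimately show "- f x + s * (f x - f y) \<le> - f (x + s *\<^sub>R (y - x))"
      by (simp add: algebra_simps)
  qed
  then show ?thesis by simp
qed

text \<open>
  On the segment from \<open>x\<close> to \<open>y\<close> the gap between the two sides is monotone, because the Lipschitz
  condition controls the sign of its derivative; no integral is needed.
\<close>
lemma lipschitz_gradient_upper_bound:
  fixes f :: "'a::euclidean_space \<Rightarrow> real"
  assumes D: "\<And>z. GDERIV f z :> Df z" and lip: "L-lipschitz_on UNIV Df"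
  shows "f y \<le> f x + Df x \<bullet> (y - x) + L / 2 * (norm (y - x))\<^sup>2"
proof -
  define d where "d = y - x"
  define \<psi> where "\<psi> s = f (x + s *\<^sub>R d) - s * (Df x \<bullet> d) - L / 2 * s\<^sup>2 * (norm d)\<^sup>2" for s
  have "\<psi> 1 \<le> \<psi> 0"
  proof (rule DERIV_nonpos_imp_nonincreasing[where f = \<psi>])
    fix s :: real assume s: "0 \<le> s" "s \<le> 1"
    have "(\<psi> has_real_derivative d \<bullet> Df (x + s *\<^sub>R d) - Df x \<bullet> d - L * s * (norm d)\<^sup>2) (at s)"
      unfolding \<psi>_def
      by (rule derivative_eq_intros GDERIV_along_line[OF D] refl | simp)+
    moreover have "d \<bullet> Df (x + s *\<^sub>R d) - Df x \<bullet> d - L * s * (norm d)\<^sup>2 \<le> 0"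
    proof -
      have "(Df (x + s *\<^sub>R d) - Df x) \<bullet> d \<le> norm (Df (x + s *\<^sub>R d) - Df x) * norm d"
        by (rule norm_cauchy_schwarz)
      also have "\<dots> \<le> (L * norm (s *\<^sub>R d)) * norm d"
        using lipschitz_onD[OF lip, of "x + s *\<^sub>R d" x]
        by (intro mult_right_mono) (auto simp: dist_norm)
      finally show ?thesis
        using s by (simp add: inner_diff_left inner_commute[of d] power2_eq_square mult.assoc)
    qed
    ultimately show "\<exists>y. (\<psi> has_real_derivative y) (at s) \<and> y \<le> 0" by blast
  qed simp
  then show ?thesis by (simp add: \<psi>_def d_def)
qed

text \<open>
  The point \<open>z\<close> below is one gradient step of length \<open>1 / L\<close> from \<open>y\<close> for the function \<open>f\<close> minus its
  linearization at \<open>x\<close>. That function is nonnegative at \<open>z\<close> by convexity, while the quadratic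
  upper bound around \<open>y\<close> shows that the step gains the squared norm of its gradient over \<open>2 * L\<close>.
\<close>
lemma smooth_convex_interpolation:
  fixes f :: "'a::euclidean_space \<Rightarrow> real"
  assumes "convex_on UNIV f" and D: "\<And>z. GDERIV f z :> Df z"
    and lip: "L-lipschitz_on UNIV Df" and "L > 0"
  shows "f x + Df x \<bullet> (y - x) + (norm (Df x - Df y))\<^sup>2 / (2 * L) \<le> f y"
proof -
  define w where "w = Df y - Df x"
  define z where "z = y - (1 / L) *\<^sub>R w"
  have "f x + Df x \<bullet> (z - x) \<le> f z"
    using convex_on_gradient_le[OF assms(1) D] .
  also have "f z \<le> f y + Df y \<bullet> (z - y) + L / 2 * (norm (z - y))\<^sup>2"
    by (rule lipschitz_gradient_upper_bound[OF D lip])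
  finally have "f x + Df x \<bullet> (z - x) \<le> f y + Df y \<bullet> (z - y) + L / 2 * (norm (z - y))\<^sup>2" .
  moreover have "Df x \<bullet> (z - x) = Df x \<bullet> (y - x) - Df x \<bullet> w / L"
    and "Df y \<bullet> (z - y) = - (Df y \<bullet> w / L)"
    by (simp_all add: z_def inner_simps)
  moreover have "L / 2 * (norm (z - y))\<^sup>2 = w \<bullet> w / (2 * L)"
    using \<open>L > 0\<close> by (simp add: z_def power2_eq_square dot_square_norm)
  moreover have "w \<bullet> w / L = Df y \<bullet> w / L - Df x \<bullet> w / L"
    by (simp add: w_def inner_simps diff_divide_distrib)
  ultimately have "f x + Df x \<bullet> (y - x) + w \<bullet> w / L - w \<bullet> w / (2 * L) \<le> f y"
    by linarith
  moreover have "w \<bullet> w = (norm (Df x - Df y))\<^sup>2"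
    by (simp add: w_def norm_minus_commute flip: power2_norm_eq_inner)
  moreover have "w \<bullet> w / L - w \<bullet> w / (2 * L) = w \<bullet> w / (2 * L)" by simp
  ultimately show ?thesis by simp
qed

section \<open>Subgradients and proximal points\<close>

text \<open>
  Finiteness at the base point is part of the notion: at a point of value \<open>\<infinity>\<close> the inequality would
  only say that the function is \<open>\<infinity>\<close> everywhere.
\<close>
definition subgradient_at :: "('a::real_inner \<Rightarrow> ereal) \<Rightarrow> 'a \<Rightarrow> 'a \<Rightarrow> bool" where
  "subgradient_at h x s \<longleftrightarrow> \<bar>h x\<bar> \<noteq> \<infinity> \<and> (\<forall>y. h x + ereal (s \<bullet> (y - x)) \<le> h y)"

lemma subgradient_at_monotone:
  assumes "subgradient_at h x s" and "subgradient_at h y u"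
  shows "0 \<le> (s - u) \<bullet> (x - y)"
proof -
  obtain a b where "h x = ereal a" "h y = ereal b"
    using assms unfolding subgradient_at_def by fastforce
  moreover have "h x + ereal (s \<bullet> (y - x)) \<le> h y" "h y + ereal (u \<bullet> (x - y)) \<le> h x"
    using assms unfolding subgradient_at_def by auto
  ultimately show ?thesis by (simp add: inner_simps)
qed

text \<open>
  Fermat's rule. It is used for the minimizer of \<open>F\<close>, where \<open>\<phi>\<close> is \<open>f\<close>, and for proximal
  points, where \<open>\<phi>\<close> is a squared distance.
\<close>
lemma subgradient_at_minimizer:
  fixes h :: "'a::euclidean_space \<Rightarrow> ereal"
  assumes "proper h" and "ereal_convex h" and "GDERIV \<phi> x :> D"
    and min: "\<And>y. ereal (\<phi> x) + h x \<le> ereal (\<phi> y) + h y"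
  shows "subgradient_at h x (- D)"
proof -
  obtain x0 where "h x0 \<noteq> \<infinity>" using assms(1) unfolding proper_def by blast
  have ninf: "h y \<noteq> - \<infinity>" for y using assms(1) unfolding proper_def by blast
  have "h x \<noteq> \<infinity>" using min[of x0] \<open>h x0 \<noteq> \<infinity>\<close> by (cases "h x0") auto
  with ninf[of x] obtain a where a: "h x = ereal a" by (cases "h x") auto
  have "h x + ereal ((- D) \<bullet> (y - x)) \<le> h y" for y
  proof (cases "h y")
    case (real b)
    \<comment> \<open>Moving towards \<open>y\<close> lowers \<open>h\<close> at rate at least \<open>a - b\<close>, which \<open>\<phi>\<close> has to make up for.\<close>
    have "a - b \<le> D \<bullet> (y - x)"
    proof (rule directional_derivative_ge[OF assms(3)])
      fix s :: real assume s: "0 < s" "s < 1"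
      define z where "z = x + s *\<^sub>R (y - x)"
      have "z = (1 - s) *\<^sub>R x + s *\<^sub>R y" by (simp add: z_def algebra_simps)
      then have "h z \<le> ereal ((1 - s) * a + s * b)"
        using assms(2)[unfolded ereal_convex_def, rule_format, of "1 - s" s x y] s a real by simp
      moreover from this ninf[of z] obtain c where "h z = ereal c" by (cases "h z") auto
      ultimately show "\<phi> x + s * (a - b) \<le> \<phi> (x + s *\<^sub>R (y - x))"
        using min[of z] a by (simp add: z_def algebra_simps)
    qed
    then show ?thesis using a real by simp
  qed (use ninf in auto)
  then show ?thesis using a by (simp add: subgradient_at_def)
qed

text \<open>
  The objective need not be continuous where it is finite, but on the epigraph of \<open>h\<close> it becomes
  the continuous function \<open>(y, r) \<mapsto> r + Q y\<close>. Its sublevel set \<open>S\<close> in the epigraph is closed because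
  \<open>h\<close> is, and bounded because the quadratic \<open>Q\<close> dominates the affine minorant given by the
  subgradient.
\<close>
lemma prox_objective_attains_min:
  fixes h :: "'a::euclidean_space \<Rightarrow> ereal"
  assumes "closed_fun h" and "proper h" and "subgradient_at h x0 s" and "c > 0"
  obtains p where "\<And>y. h p + ereal (c * (norm (p - z))\<^sup>2) \<le> h y + ereal (c * (norm (y - z))\<^sup>2)"
proof -
  define Q where "Q y = c * (norm (y - z))\<^sup>2" for y
  obtain r0 where r0: "h x0 = ereal r0"
    using assms(3) unfolding subgradient_at_def by fastforce
  define K where "K = r0 + Q x0"
  define \<alpha> where "\<alpha> = r0 + s \<bullet> (z - x0)"
  have minorant: "\<alpha> - norm s * norm (y - z) \<le> r" if "h y \<le> ereal r" for y r
  proof -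
    have "ereal (r0 + s \<bullet> (y - x0)) \<le> h y"
      using assms(3) r0 unfolding subgradient_at_def by (metis plus_ereal.simps(1))
    then have "r0 + s \<bullet> (y - x0) \<le> r" using that by (metis ereal_less_eq(3) order_trans)
    moreover have "- (norm s * norm (y - z)) \<le> s \<bullet> (y - z)"
      using Cauchy_Schwarz_ineq2[of s "y - z"] by linarith
    ultimately show ?thesis unfolding \<alpha>_def by (simp add: inner_simps)
  qed
  \<comment> \<open>Beyond distance \<open>1\<close> the constant \<open>\<bar>K - \<alpha>\<bar>\<close> is at most linear in the distance, so that the
    quadratic inequality for the distance can be divided by it.\<close>
  define R where "R = max 1 ((\<bar>K - \<alpha>\<bar> + norm s) / c)"
  define S where "S = {(y, r). h y \<le> ereal r} \<inter> {(y, r). r + Q y \<le> K}"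
  have "S \<subseteq> cball z R \<times> {\<alpha> - norm s * R..K}"
  proof clarify
    fix y r assume "(y, r) \<in> S"
    then have h: "h y \<le> ereal r" and r: "r + Q y \<le> K" by (auto simp: S_def)
    define \<rho> where "\<rho> = norm (y - z)"
    have "c * \<rho>\<^sup>2 \<le> (K - \<alpha>) + norm s * \<rho>"
      using minorant[OF h] r by (simp add: Q_def \<rho>_def)
    have "\<rho> \<le> R"
    proof (cases "\<rho> \<le> 1")
      case False
      then have "\<bar>K - \<alpha>\<bar> * 1 \<le> \<bar>K - \<alpha>\<bar> * \<rho>" by (intro mult_left_mono) auto
      then have "(c * \<rho>) * \<rho> \<le> (\<bar>K - \<alpha>\<bar> + norm s) * \<rho>"
        using \<open>c * \<rho>\<^sup>2 \<le> _\<close> by (simp add: power2_eq_square algebra_simps)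
      then have "c * \<rho> \<le> \<bar>K - \<alpha>\<bar> + norm s" using False by simp
      then show ?thesis using \<open>c > 0\<close> by (simp add: R_def field_simps le_max_iff_disj)
    qed (simp add: R_def)
    moreover from this have "norm s * \<rho> \<le> norm s * R" by (intro mult_left_mono) auto
    moreover have "0 \<le> Q y" using \<open>c > 0\<close> by (simp add: Q_def)
    ultimately show "y \<in> cball z R \<and> r \<in> {\<alpha> - norm s * R..K}"
      using minorant[OF h] r by (auto simp: \<rho>_def dist_norm norm_minus_commute)
  qed
  moreover have "closed S"
    unfolding S_def
  proof (rule closed_Int)
    show "closed {(y, r::real). h y \<le> ereal r}" using assms(1) by (simp add: closed_fun_def)
    show "closed {(y, r). r + Q y \<le> K}"
      unfolding Q_def case_prod_unfold by (intro closed_Collect_le continuous_intros)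
  qed
  ultimately have "compact S"
    by (metis compact_Int_closed compact_Times compact_cball compact_Icc Int_absorb1)
  moreover have "(x0, r0) \<in> S" using r0 by (simp add: S_def K_def)
  moreover have "continuous_on S (\<lambda>(y, r). r + Q y)"
    unfolding Q_def case_prod_unfold by (intro continuous_intros)
  ultimately obtain p r where pr: "(p, r) \<in> S" and
    min: "\<And>y u. (y, u) \<in> S \<Longrightarrow> r + Q p \<le> u + Q y"
    using continuous_attains_inf[of S "\<lambda>(y, r). r + Q y"] by fast
  have "h p + ereal (Q p) \<le> h y + ereal (Q y)" for y
  proof -
    have "h p + ereal (Q p) \<le> ereal (r + Q p)"
      using pr add_right_mono[of "h p" "ereal r" "ereal (Q p)"] by (simp add: S_def)
    also have "\<dots> \<le> h y + ereal (Q y)"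
    proof (cases "h y")
      case (real u)
      have "r + Q p \<le> K" using pr by (simp add: S_def)
      then have "r + Q p \<le> u + Q y"
        using min[of y u] real by (cases "u + Q y \<le> K") (auto simp: S_def)
      then show ?thesis using real by simp
    qed (use assms(2) in \<open>auto simp: proper_def\<close>)
    finally show ?thesis .
  qed
  then show ?thesis using that[of p] by (simp add: Q_def)
qed

text \<open>
  The optimality condition of the proximal step; the residual minus the gradient is the rescaled
  displacement from the proximal point to the point whose proximal point is taken.
\<close>
lemma prox_grad_step_subgradient:
  fixes h :: "'a::euclidean_space \<Rightarrow> ereal"
  assumes "closed_fun h" and "proper h" and "ereal_convex h" and "subgradient_at h x0 s"
    and "\<gamma> > 0"
  shows "subgradient_at h (prox_grad_step f h \<gamma> x) (residual f h \<gamma> x - gradient f x)"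
proof -
  define z where "z = x - \<gamma> *\<^sub>R gradient f x"
  define p where "p = prox_grad_step f h \<gamma> x"
  define obj where "obj y = ereal \<gamma> * h y + ereal (1/2 * (norm (y - z))\<^sup>2)" for y
  have "obj y = ereal \<gamma> * (h y + ereal (1 / (2 * \<gamma>) * (norm (y - z))\<^sup>2))" for y
    using \<open>\<gamma> > 0\<close> unfolding obj_def by (cases "h y") (simp_all add: field_simps)
  then have obj_le: "obj y \<le> obj y' \<longleftrightarrow> h y + ereal (1 / (2 * \<gamma>) * (norm (y - z))\<^sup>2)
      \<le> h y' + ereal (1 / (2 * \<gamma>) * (norm (y' - z))\<^sup>2)" for y y'
    using \<open>\<gamma> > 0\<close> by (simp add: ereal_mult_le_mult_iff)
  obtain q where "\<And>y. h q + ereal (1 / (2 * \<gamma>) * (norm (q - z))\<^sup>2)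
      \<le> h y + ereal (1 / (2 * \<gamma>) * (norm (y - z))\<^sup>2)"
    using prox_objective_attains_min[OF assms(1,2,4), of "1 / (2 * \<gamma>)" z] \<open>\<gamma> > 0\<close> by auto
  then have "is_arg_min obj (\<lambda>_. True) q"
    by (auto simp: is_arg_min_def not_less obj_le)
  moreover have "p = arg_min obj (\<lambda>_. True)"
    by (simp add: p_def prox_grad_step_def prox_def obj_def[abs_def] z_def)
  ultimately have "is_arg_min obj (\<lambda>_. True) p"
    unfolding arg_min_def by (metis someI)
  then have "obj p \<le> obj y" for y
    by (simp add: is_arg_min_def not_less)
  then have min: "ereal (1 / (2 * \<gamma>) * (norm (p - z))\<^sup>2) + h p
      \<le> ereal (1 / (2 * \<gamma>) * (norm (y - z))\<^sup>2) + h y" for y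
    using obj_le by (simp add: add.commute)
  have "GDERIV (\<lambda>y. 1 / (2 * \<gamma>) * (norm (y - z))\<^sup>2) p :> (1 / \<gamma>) *\<^sub>R (p - z)"
    unfolding gderiv_def power2_norm_eq_inner using \<open>\<gamma> > 0\<close>
    by (auto intro!: derivative_eq_intros simp: inner_commute inner_simps field_simps)
  from subgradient_at_minimizer[OF assms(2,3) this min]
  have "subgradient_at h p (- ((1 / \<gamma>) *\<^sub>R (p - z)))" .
  moreover have "- ((1 / \<gamma>) *\<^sub>R (p - z)) = residual f h \<gamma> x - gradient f x"
    using \<open>\<gamma> > 0\<close> by (simp add: residual_def z_def algebra_simps flip: p_def)
  ultimately show ?thesis by (simp add: p_def)
qed

text \<open>
  Monotonicity of the subdifferential of \<open>h\<close> between \<open>x\<close> and its proximal gradient step bounds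
  the squared norm of the residual by its inner product with the subgradient
  \<open>gradient f x + s\<close> of the composite function, and Cauchy-Schwarz finishes.
\<close>
lemma norm_residual_le_subgradient:
  fixes h :: "'a::euclidean_space \<Rightarrow> ereal"
  assumes "closed_fun h" and "proper h" and "ereal_convex h" and "subgradient_at h x s"
    and "\<gamma> > 0"
  shows "norm (residual f h \<gamma> x) \<le> norm (gradient f x + s)"
proof -
  define G where "G = residual f h \<gamma> x"
  define p where "p = prox_grad_step f h \<gamma> x"
  have "x - p = \<gamma> *\<^sub>R G" using \<open>\<gamma> > 0\<close> by (simp add: G_def residual_def p_def)
  moreover have "subgradient_at h p (G - gradient f x)"
    unfolding p_def G_def using prox_grad_step_subgradient[OF assms] .
  then have "0 \<le> (s - (G - gradient f x)) \<bullet> (x - p)"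
    by (rule subgradient_at_monotone[OF assms(4)])
  ultimately have "G \<bullet> G \<le> (gradient f x + s) \<bullet> G"
    using \<open>\<gamma> > 0\<close> by (simp add: inner_simps zero_le_mult_iff)
  also have "\<dots> \<le> norm (gradient f x + s) * norm G" by (rule norm_cauchy_schwarz)
  finally have "norm G * norm G \<le> norm (gradient f x + s) * norm G"
    by (simp add: power2_eq_square flip: power2_norm_eq_inner)
  then have "norm G \<le> norm (gradient f x + s)"
    by (cases "G = 0") auto
  then show ?thesis by (simp add: G_def)
qed

section \<open>Decrease of the objective in one step\<close>

text \<open>
  Multiplied by \<open>2 * L\<close>, the two hypotheses sandwich \<open>2 * L * E\<close>; eliminating \<open>E\<close> leaves the
  cocoercivity inequality \<open>coc\<close>. Short steps need the lower bound alone. For longer steps the inner product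
  \<open>c\<close> enters the lower bound with a positive coefficient and is estimated through \<open>coc\<close>. Up to
  \<open>\<gamma> * L = 3 / 2\<close> it can be eliminated outright. Beyond that, one also removes the
  squared norm of \<open>G\<close>: the bound is tight for \<open>v = - (p *\<^sub>R G)\<close> with \<open>p = \<gamma> * L - 1\<close>, the gradients
  along a one-dimensional quadratic of curvature \<open>L\<close>, and the slack is a multiple of the squared
  norm of \<open>v + p *\<^sub>R G\<close>.
\<close>
lemma decrease_bounds:
  fixes G v :: "'a::real_inner"
  assumes "L > 0" and "\<gamma> > 0"
    and lower: "\<gamma> * (v \<bullet> G) + (norm (G - v))\<^sup>2 / (2 * L) \<le> E"
    and upper: "E \<le> \<gamma> * (norm G)\<^sup>2 - (norm (G - v))\<^sup>2 / (2 * L)"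
  shows "\<gamma> * L \<le> 1 \<Longrightarrow> \<gamma> / 2 * ((norm G)\<^sup>2 + (norm v)\<^sup>2) \<le> E" (is "_ \<Longrightarrow> ?short")
    and "1 \<le> \<gamma> * L \<Longrightarrow> \<gamma> * L < 2 \<Longrightarrow>
      \<gamma> * ((3 - 2 * (\<gamma> * L)) * (norm G)\<^sup>2 + (norm v)\<^sup>2) \<le> 2 * (2 - \<gamma> * L) * E"
      (is "_ \<Longrightarrow> _ \<Longrightarrow> ?medium")
    and "3 / 2 \<le> \<gamma> * L \<Longrightarrow> \<gamma> * L < 2 \<Longrightarrow>
      \<gamma> * (2 - \<gamma> * L) * (norm v)\<^sup>2 \<le> 2 * (\<gamma> * L - 1)\<^sup>2 * E"
      (is "_ \<Longrightarrow> _ \<Longrightarrow> ?long")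
proof -
  define t a b c where "t = \<gamma> * L" and "a = (norm G)\<^sup>2" and "b = (norm v)\<^sup>2" and "c = v \<bullet> G"
  have w: "(norm (G - v))\<^sup>2 = a + b - 2 * c"
    by (simp add: a_def b_def c_def power2_norm_eq_inner inner_simps inner_commute)
  have lo: "2 * t * c + (a + b - 2 * c) \<le> 2 * L * E"
    using lower \<open>L > 0\<close> by (simp add: w t_def field_simps flip: c_def)
  have "2 * L * E \<le> 2 * t * a - (a + b - 2 * c)"
    using upper \<open>L > 0\<close> by (simp add: w t_def field_simps flip: a_def)
  with lo have coc: "a + b - 2 * c \<le> t * (a - c)"
    by (simp add: algebra_simps)
  have cancel: "\<gamma> * A \<le> B" if "t * A \<le> L * B" for A B
    using that \<open>L > 0\<close> by (simp add: t_def mult.commute mult.left_commute)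
  show ?short if "\<gamma> * L \<le> 1"
  proof -
    \<comment> \<open>Times \<open>2 * L\<close>, the lower bound is \<open>t * (a + b) + (1 - t) * (a + b - 2 * c)\<close>.\<close>
    have "0 \<le> (1 - t) * (a + b - 2 * c)"
      using that w by (metis mult_nonneg_nonneg diff_ge_0_iff_ge t_def zero_le_power2)
    with lo have "t * (a + b) \<le> L * (2 * E)" by (simp add: algebra_simps)
    from cancel[OF this] show ?thesis by (simp add: a_def b_def)
  qed
  show ?medium if "1 \<le> \<gamma> * L" "\<gamma> * L < 2"
  proof -
    \<comment> \<open>The weights \<open>2 - t\<close> and \<open>2 * (t - 1)\<close> are those for which \<open>c\<close> cancels.\<close>
    have "(2 - t) * (2 * t * c + (a + b - 2 * c)) \<le> (2 - t) * (2 * L * E)"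
      using lo that by (intro mult_left_mono) (auto simp: t_def)
    moreover have "2 * (t - 1) * (a + b - 2 * c) \<le> 2 * (t - 1) * (t * (a - c))"
      using coc that by (intro mult_left_mono) (auto simp: t_def)
    ultimately have "t * ((3 - 2 * t) * a + b) \<le> L * (2 * (2 - t) * E)"
      by (simp add: algebra_simps)
    from cancel[OF this] show ?thesis by (simp add: a_def b_def t_def)
  qed
  show ?long if "3 / 2 \<le> \<gamma> * L" "\<gamma> * L < 2"
  proof -
    define p where "p = t - 1"
    have p: "1 / 2 \<le> p" "p < 1" using that by (auto simp: p_def t_def)
    \<comment> \<open>The weight of \<open>coc\<close> makes the difference of the two sides stationary at \<open>v = - (p *\<^sub>R G)\<close>;
      what remains is a perfect square with weight \<open>2 * p - 1\<close>.\<close>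
    have "p\<^sup>2 * (2 * t * c + (a + b - 2 * c)) \<le> p\<^sup>2 * (2 * L * E)"
      using lo by (intro mult_left_mono) auto
    moreover have "2 * p * (1 - p) * (a + b - 2 * c) \<le> 2 * p * (1 - p) * (t * (a - c))"
      using coc p by (intro mult_left_mono) auto
    moreover have "0 \<le> (2 * p - 1) * (b + 2 * p * c + p\<^sup>2 * a)"
    proof -
      have "b + 2 * p * c + p\<^sup>2 * a = (norm (v + p *\<^sub>R G))\<^sup>2"
        unfolding power2_norm_eq_inner a_def b_def c_def
        by (simp add: inner_simps inner_commute power2_eq_square algebra_simps)
      then show ?thesis using p by simp
    qed
    ultimately have "t * ((2 - t) * b) \<le> L * (2 * p\<^sup>2 * E)"
      by (simp add: p_def algebra_simps power2_eq_square)
    from cancel[OF this] show ?thesis by (simp add: b_def t_def p_def mult.assoc)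
  qed
qed

text \<open>
  The number \<open>E\<close> is the decrease of \<open>f\<close> plus the part of the decrease of \<open>h\<close> that its subgradient
  at \<open>x2\<close> guarantees. The true decrease of \<open>F\<close> has no upper bound in terms of \<open>G\<close> and \<open>v\<close>,
  since nothing limits \<open>h\<close> at \<open>x1\<close> from above; for \<open>E\<close> the upper bound needs \<open>f\<close> only.
\<close>
lemma prox_grad_step_decrease_sandwich:
  fixes f :: "'a::euclidean_space \<Rightarrow> real"
  assumes "convex_on UNIV f" and D: "\<And>z. GDERIV f z :> gradient f z"
    and "L-lipschitz_on UNIV (gradient f)" and "L > 0" and "\<gamma> > 0"
    and x2: "x2 = prox_grad_step f h \<gamma> x1"
    and G: "G = residual f h \<gamma> x1"
    and sub: "subgradient_at h x2 (G - gradient f x1)"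
    and v: "v = gradient f x2 + (G - gradient f x1)"
    and h: "h x1 = ereal h1" "h x2 = ereal h2"
  obtains E where "E \<le> (f x1 + h1) - (f x2 + h2)"
    and "\<gamma> * (v \<bullet> G) + (norm (G - v))\<^sup>2 / (2 * L) \<le> E"
    and "E \<le> \<gamma> * (norm G)\<^sup>2 - (norm (G - v))\<^sup>2 / (2 * L)"
proof
  define g1 g2 where "g1 = gradient f x1" and "g2 = gradient f x2"
  define E where "E = f x1 - f x2 + \<gamma> * ((G - g1) \<bullet> G)"
  have step: "x1 - x2 = \<gamma> *\<^sub>R G" "x2 - x1 = - (\<gamma> *\<^sub>R G)"
    using \<open>\<gamma> > 0\<close> by (simp_all add: x2 G residual_def)
  have w: "G - v = g1 - g2" by (simp add: v g1_def g2_def)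
  note interpolation = smooth_convex_interpolation[OF assms(1) D assms(3,4)]
  have "h2 + (G - g1) \<bullet> (x1 - x2) \<le> h1"
    using sub h unfolding subgradient_at_def g1_def by (metis plus_ereal.simps(1) ereal_less_eq(3))
  then show "E \<le> (f x1 + h1) - (f x2 + h2)"
    by (simp add: E_def step)
  have "f x2 + g2 \<bullet> (x1 - x2) + (norm (G - v))\<^sup>2 / (2 * L) \<le> f x1"
    using interpolation[of x2 x1] by (simp add: w g1_def g2_def norm_minus_commute)
  then show "\<gamma> * (v \<bullet> G) + (norm (G - v))\<^sup>2 / (2 * L) \<le> E"
    by (simp add: E_def step v g1_def g2_def algebra_simps)
  have "f x1 + g1 \<bullet> (x2 - x1) + (norm (G - v))\<^sup>2 / (2 * L) \<le> f x2"
    using interpolation[of x1 x2] by (simp add: w g1_def g2_def)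
  then show "E \<le> \<gamma> * (norm G)\<^sup>2 - (norm (G - v))\<^sup>2 / (2 * L)"
    by (simp add: E_def step power2_norm_eq_inner algebra_simps)
qed

section \<open>Linear rates under the RPL inequality\<close>

theorem theorem7:
  fixes f :: "real ^ 'n \<Rightarrow> real"
    and h F :: "real ^ 'n \<Rightarrow> ereal"
    and F_star :: ereal
    and L \<mu> \<gamma> :: real
    and x1 x2 :: "real ^ 'n"
    and X :: "(real ^ 'n) set"
  assumes "L > 0" and "\<mu> > 0"
    and "convex_on UNIV f"
    and "\<forall>x. f differentiable (at x)"
    and "L-lipschitz_on UNIV (gradient f)"
    and "closed_fun h" and "proper h" and "ereal_convex h"
    and "F = (\<lambda>x. ereal (f x) + h x)"
    and "{x. is_arg_min F (\<lambda>_. True) x} \<noteq> {}"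
    and "F_star = (INF x. F x)"
    and "0 < \<gamma>" and "\<gamma> < 2 / L"
    and "X = {x. F x \<le> F x1}"
    and "\<forall>x\<in>X. ereal ((norm (residual f h \<gamma> x))\<^sup>2) \<ge> ereal (2 * \<mu>) * (F x - F_star)"
    and "x2 = prox_grad_step f h \<gamma> x1"
  shows "(\<gamma> \<in> {0<..1 / L} \<longrightarrow>
            F x2 - F_star \<le> ereal ((1 - \<gamma> * \<mu>) / (1 + \<gamma> * \<mu>)) * (F x1 - F_star)) \<and>
         (\<gamma> \<in> {1 / L<..3 / (2 * L)} \<longrightarrow>
            F x2 - F_star \<le>
              ereal ((-2 * L * \<gamma>\<^sup>2 * \<mu> + L * \<gamma> + 3 * \<gamma> * \<mu> - 2) / (L * \<gamma> - \<gamma> * \<mu> - 2))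
                * (F x1 - F_star)) \<and>
         (\<gamma> \<in> {3 / (2 * L)<..<2 / L} \<longrightarrow>
            F x2 - F_star \<le>
              ereal ((L * \<gamma> - 1)\<^sup>2 / ((L * \<gamma> - 1)\<^sup>2 - L * \<gamma>\<^sup>2 * \<mu> + 2 * \<gamma> * \<mu>))
                * (F x1 - F_star))"
proof -
  have D: "GDERIV f z :> gradient f z" for z
    using assms(4) by (simp add: GDERIV_gradient)
  obtain xs where xs: "\<And>y. F xs \<le> F y"
    using assms(10) by (auto simp: is_arg_min_def not_less)
  have minorant: "subgradient_at h xs (- gradient f xs)"
    using subgradient_at_minimizer[OF assms(7,8) D] xs by (simp add: assms(9))
  then obtain Fs where "F xs = ereal Fs"
    by (cases "h xs") (auto simp: subgradient_at_def assms(9))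
  moreover have "F_star = F xs"
    unfolding assms(11) using xs by (intro antisym INF_lower INF_greatest) auto
  ultimately have Fs: "F_star = ereal Fs" by simp

  \<comment> \<open>The RPL inequality at \<open>x1\<close> bounds \<open>F x1\<close> by the norm of the residual, which is real.\<close>
  have "h x1 \<noteq> \<infinity>"
  proof
    assume "h x1 = \<infinity>"
    then show False
      using assms(15)[rule_format, of x1] \<open>\<mu> > 0\<close> by (simp add: Fs assms(9,14))
  qed
  moreover have "h x1 \<noteq> - \<infinity>" using assms(7) by (simp add: proper_def)
  ultimately obtain h1 where h1: "h x1 = ereal h1" by (cases "h x1") auto
  define G where "G = residual f h \<gamma> x1"
  define v where "v = gradient f x2 + (G - gradient f x1)"
  have sub: "subgradient_at h x2 (G - gradient f x1)"
    unfolding G_def assms(16)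
    using prox_grad_step_subgradient[OF assms(6,7,8) minorant \<open>0 < \<gamma>\<close>] .
  then obtain h2 where h2: "h x2 = ereal h2"
    by (cases "h x2") (auto simp: subgradient_at_def)
  define \<Delta>1 \<Delta>2 where "\<Delta>1 = f x1 + h1 - Fs" and "\<Delta>2 = f x2 + h2 - Fs"
  have F1: "F x1 - F_star = ereal \<Delta>1" and F2: "F x2 - F_star = ereal \<Delta>2"
    by (simp_all add: assms(9) Fs h1 h2 \<Delta>1_def \<Delta>2_def)
  obtain E where E: "E \<le> \<Delta>1 - \<Delta>2"
    and lower: "\<gamma> * (v \<bullet> G) + (norm (G - v))\<^sup>2 / (2 * L) \<le> E"
    and upper: "E \<le> \<gamma> * (norm G)\<^sup>2 - (norm (G - v))\<^sup>2 / (2 * L)"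
    using prox_grad_step_decrease_sandwich[OF assms(3) D assms(5,1,12,16) G_def sub v_def h1 h2]
    unfolding \<Delta>1_def \<Delta>2_def by (smt (verit))
  note bounds = decrease_bounds[OF assms(1,12) lower upper]

  have rpl1: "2 * \<mu> * \<Delta>1 \<le> (norm G)\<^sup>2"
    using assms(15)[rule_format, of x1] by (simp add: F1 G_def assms(14))
  have rpl2: "2 * \<mu> * \<Delta>2 \<le> (norm v)\<^sup>2" if "0 \<le> E"
  proof -
    have "x2 \<in> X" using that E by (simp add: assms(9,14) h1 h2 \<Delta>1_def \<Delta>2_def)
    then have "2 * \<mu> * \<Delta>2 \<le> (norm (residual f h \<gamma> x2))\<^sup>2"
      using assms(15) F2 by auto
    also have "\<dots> \<le> (norm v)\<^sup>2"
      using norm_residual_le_subgradient[OF assms(6,7,8) sub \<open>0 < \<gamma>\<close>, of f]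
      by (simp add: v_def power_mono)
    finally show ?thesis .
  qed
  define t where "t = \<gamma> * L"
  have "t < 2" using \<open>\<gamma> < 2 / L\<close> \<open>L > 0\<close> by (simp add: t_def field_simps)
  have "0 < \<gamma> * \<mu>" using \<open>0 < \<gamma>\<close> \<open>\<mu> > 0\<close> by simp

  have "\<Delta>2 \<le> (1 - \<gamma> * \<mu>) / (1 + \<gamma> * \<mu>) * \<Delta>1" if "\<gamma> \<in> {0<..1 / L}"
  proof -
    have "t \<le> 1" using that \<open>L > 0\<close> by (simp add: t_def field_simps)
    then have short: "\<gamma> / 2 * ((norm G)\<^sup>2 + (norm v)\<^sup>2) \<le> E"
      using bounds(1) by (simp add: t_def)
    moreover have "0 \<le> \<gamma> / 2 * ((norm G)\<^sup>2 + (norm v)\<^sup>2)" using \<open>0 < \<gamma>\<close> by simp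
    ultimately have "0 \<le> E" by linarith
    have "\<gamma> / 2 * (2 * \<mu> * \<Delta>1 + 2 * \<mu> * \<Delta>2) \<le> \<gamma> / 2 * ((norm G)\<^sup>2 + (norm v)\<^sup>2)"
      using rpl1 rpl2[OF \<open>0 \<le> E\<close>] \<open>0 < \<gamma>\<close> by (intro mult_left_mono add_mono) auto
    with short E have "\<Delta>2 * (1 + \<gamma> * \<mu>) \<le> (1 - \<gamma> * \<mu>) * \<Delta>1"
      by (simp add: algebra_simps)
    then show ?thesis using \<open>0 < \<gamma> * \<mu>\<close> by (simp add: pos_le_divide_eq)
  qed
  moreover have "\<Delta>2 \<le> (-2 * L * \<gamma>\<^sup>2 * \<mu> + L * \<gamma> + 3 * \<gamma> * \<mu> - 2) / (L * \<gamma> - \<gamma> * \<mu> - 2) * \<Delta>1"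
    if "\<gamma> \<in> {1 / L<..3 / (2 * L)}"
  proof -
    have t: "1 \<le> t" "0 \<le> 3 - 2 * t" using that \<open>L > 0\<close> by (simp_all add: t_def field_simps)
    then have medium: "\<gamma> * ((3 - 2 * t) * (norm G)\<^sup>2 + (norm v)\<^sup>2) \<le> 2 * (2 - t) * E"
      using bounds(2) \<open>t < 2\<close> by (simp add: t_def)
    moreover have "0 \<le> \<gamma> * ((3 - 2 * t) * (norm G)\<^sup>2 + (norm v)\<^sup>2)" using \<open>0 < \<gamma>\<close> t by simp
    ultimately have "0 \<le> 2 * (2 - t) * E" by linarith
    then have "0 \<le> E" using \<open>t < 2\<close> by (simp add: zero_le_mult_iff)
    have "\<gamma> * ((3 - 2 * t) * (2 * \<mu> * \<Delta>1) + 2 * \<mu> * \<Delta>2)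
        \<le> \<gamma> * ((3 - 2 * t) * (norm G)\<^sup>2 + (norm v)\<^sup>2)"
      using rpl1 rpl2[OF \<open>0 \<le> E\<close>] \<open>0 < \<gamma>\<close> t by (intro mult_left_mono add_mono) auto
    moreover have "2 * (2 - t) * E \<le> 2 * (2 - t) * (\<Delta>1 - \<Delta>2)"
      using E \<open>t < 2\<close> by (intro mult_left_mono) auto
    ultimately have "\<Delta>2 * (2 - t + \<gamma> * \<mu>) \<le> (2 - t - \<gamma> * \<mu> * (3 - 2 * t)) * \<Delta>1"
      using medium by (simp add: algebra_simps)
    moreover have "0 < 2 - t + \<gamma> * \<mu>" using \<open>t < 2\<close> \<open>0 < \<gamma> * \<mu>\<close> by simp
    ultimately have "\<Delta>2 \<le> (2 - t - \<gamma> * \<mu> * (3 - 2 * t)) / (2 - t + \<gamma> * \<mu>) * \<Delta>1"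
      by (simp add: pos_le_divide_eq)
    \<comment> \<open>In the stated fraction both numerator and denominator carry the opposite sign.\<close>
    also have "(2 - t - \<gamma> * \<mu> * (3 - 2 * t)) / (2 - t + \<gamma> * \<mu>)
        = (- (2 - t - \<gamma> * \<mu> * (3 - 2 * t))) / (- (2 - t + \<gamma> * \<mu>))"
      by (simp only: minus_divide_divide)
    also have "\<dots> = (-2 * L * \<gamma>\<^sup>2 * \<mu> + L * \<gamma> + 3 * \<gamma> * \<mu> - 2) / (L * \<gamma> - \<gamma> * \<mu> - 2)"
      by (simp add: t_def power2_eq_square algebra_simps)
    finally show ?thesis .
  qed
  moreover have "\<Delta>2 \<le> (L * \<gamma> - 1)\<^sup>2 / ((L * \<gamma> - 1)\<^sup>2 - L * \<gamma>\<^sup>2 * \<mu> + 2 * \<gamma> * \<mu>) * \<Delta>1"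
    if "\<gamma> \<in> {3 / (2 * L)<..<2 / L}"
  proof -
    have t: "3 / 2 < t" using that \<open>L > 0\<close> by (simp add: t_def field_simps)
    then have long: "\<gamma> * (2 - t) * (norm v)\<^sup>2 \<le> 2 * (t - 1)\<^sup>2 * E"
      using bounds(3) \<open>t < 2\<close> by (simp add: t_def)
    moreover have "0 \<le> \<gamma> * (2 - t) * (norm v)\<^sup>2" using \<open>0 < \<gamma>\<close> \<open>t < 2\<close> by simp
    ultimately have "0 \<le> 2 * (t - 1)\<^sup>2 * E" by linarith
    then have "0 \<le> E" using t by (simp add: zero_le_mult_iff)
    have "\<gamma> * (2 - t) * (2 * \<mu> * \<Delta>2) \<le> \<gamma> * (2 - t) * (norm v)\<^sup>2"
      using rpl2[OF \<open>0 \<le> E\<close>] \<open>0 < \<gamma>\<close> \<open>t < 2\<close> by (intro mult_left_mono) auto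
    moreover have "2 * (t - 1)\<^sup>2 * E \<le> 2 * (t - 1)\<^sup>2 * (\<Delta>1 - \<Delta>2)"
      using E by (intro mult_left_mono) auto
    ultimately have "\<Delta>2 * ((t - 1)\<^sup>2 + \<gamma> * \<mu> * (2 - t)) \<le> (t - 1)\<^sup>2 * \<Delta>1"
      using long by (simp add: algebra_simps)
    moreover have "0 < (t - 1)\<^sup>2 + \<gamma> * \<mu> * (2 - t)"
      using \<open>t < 2\<close> \<open>0 < \<gamma> * \<mu>\<close> by (intro add_nonneg_pos) auto
    ultimately have "\<Delta>2 \<le> (t - 1)\<^sup>2 / ((t - 1)\<^sup>2 + \<gamma> * \<mu> * (2 - t)) * \<Delta>1"
      by (simp add: pos_le_divide_eq)
    also have "(t - 1)\<^sup>2 + \<gamma> * \<mu> * (2 - t) = (L * \<gamma> - 1)\<^sup>2 - L * \<gamma>\<^sup>2 * \<mu> + 2 * \<gamma> * \<mu>"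
      by (simp add: t_def power2_eq_square algebra_simps)
    finally show ?thesis by (simp add: t_def mult.commute)
  qed
  ultimately show ?thesis unfolding F1 F2 by simp
qed

end
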